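(* Let $\sigma=\sigma_1\cdots\sigma_k$ be a permutation of length $k\ge 3$ and let $\hat\sigma=\sigma_2\sigma_1\sigma_3\cdots\sigma_k$. The following three conditions are equivalent: \begin{enumerate} \item[(1)] $\mathrm{Sort}(\sigma)\not\subseteq\mathfrak{S}(\xi)$. \item[(2)] $\sigma=12\ominus\beta$, for some $\beta\in\mathfrak{S}(231)$. \item[(3)] $\hat\sigma\in\mathfrak{S}(231)$ and $\mathcal{R}(\sigma)\notin\mathfrak{S}(\xi)$. \end{enumerate}
   Context: Permutations are written in one-line notation. A permutation contains a classical pattern $\tau$ if some subsequence is order isomorphic to $\tau$; otherwise it avoids $\tau$. $\mathfrak{S}(\tau)$ denotes the set of permutations avoiding $\tau$. $\xi$ is the bivincular pattern $(132,\{0,2\},\emptyset)$: a permutation $\pi=\pi_1\cdots\pi_n$ contains $\xi$ if there is an index $i\ge 2$ with $i+1\le n$ and $\pi_1<\pi_{i+1}<\pi_i$; otherwise it avoids $\xi$, and $\mathfrak{S}(\xi)$ is the set of permutations avoiding $\xi$. $\mathcal{R}(\sigma)=\sigma_k\cdots\sigma_1$ is the reverse. The skew sum $x\ominus y$ of permutations $x$ (length $a$) and $y$ (length $b$) is the permutation of length $a+b$ whose first $a$ entries are order isomorphic to $x$, whose last $b$ entries are order isomorphic to $y$, and in which each of the first $a$ entries is larger than each of the last $b$ entries. For a permutation $\sigma$ of length at least $2$, the $\sigma$-stack acts on an input permutation $\pi=\pi_1\cdots\pi_n$ as follows (starting with empty stack and output). For $i=1,\dots,n$: as long as pushing $\pi_i$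 on top of the stack would make the content of the stack, read from top to bottom, contain an occurrence of $\sigma$, pop the top element and append it to the output; then push $\pi_i$. After all letters have been pushed, pop all remaining elements, from top to bottom, appending them to the output. The resulting output is denoted $\mathcal{S}^{\sigma}(\pi)$. The permutation $\pi$ of length $n$ is $\sigma$-sortable if $\mathcal{S}^{21}(\mathcal{S}^{\sigma}(\pi))=12\cdots n$. $\mathrm{Sort}(\sigma)$ is the set of $\sigma$-sortable permutations. *)

theory Defs
  imports Main "HOL-Library.Sublist"
begin

text \<open>
  A permutation of length \<open>n\<close> is its one-line notation, a list over \<open>{1..n}\<close>. List
  positions start at 0, so the entry with index \<open>i\<close> is \<open>p ! (i - 1)\<close>.
\<close>

definition is_perm :: "nat list \<Rightarrow> bool" where
  "is_perm p \<longleftrightarrow> distinct p \<and> set p = {1..length p}"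

definition order_iso :: "nat list \<Rightarrow> nat list \<Rightarrow> bool" where
  "order_iso xs ys \<longleftrightarrow> length xs = length ys \<and>
     (\<forall>i<length xs. \<forall>j<length xs. xs ! i < xs ! j \<longleftrightarrow> ys ! i < ys ! j)"

text \<open>The containing list need not be a permutation: the content of a stack is not.\<close>

definition contains :: "nat list \<Rightarrow> nat list \<Rightarrow> bool" where
  "contains xs \<tau> \<longleftrightarrow> (\<exists>ys. subseq ys xs \<and> order_iso ys \<tau>)"

definition Av :: "nat list \<Rightarrow> nat list set" where
  "Av \<tau> = {p. is_perm p \<and> \<not> contains p \<tau>}"

definition contains_xi :: "nat list \<Rightarrow> bool" where
  "contains_xi p \<longleftrightarrow>
     (\<exists>i\<ge>2. i + 1 \<le> length p \<and> p ! 0 < p ! i \<and> p ! i < p ! (i - 1))"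

definition Av_xi :: "nat list set" where
  "Av_xi = {p. is_perm p \<and> \<not> contains_xi p}"

definition skew_sum :: "nat list \<Rightarrow> nat list \<Rightarrow> nat list" (infixl "\<ominus>" 65) where
  "x \<ominus> y = map (\<lambda>i. i + length y) x @ y"

fun hat :: "nat list \<Rightarrow> nat list" where
  "hat (a # b # p) = b # a # p"
| "hat p = p"

text \<open>
  A stack is the list of its entries from top to bottom. \<open>push \<sigma> a st out\<close> pops from \<open>st\<close> to
  the end of \<open>out\<close> as long as pushing \<open>a\<close> would create an occurrence of \<open>\<sigma>\<close>, and then pushes
  \<open>a\<close>. A one-entry stack contains no pattern of length at least 2, so on the empty stack no
  test is needed.
\<close>

fun push :: "nat list \<Rightarrow> nat \<Rightarrow> nat list \<Rightarrow> nat list \<Rightarrow> nat list \<times> nat list" where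
  "push \<sigma> a [] out = ([a], out)"
| "push \<sigma> a (t # st) out =
     (if contains (a # t # st) \<sigma> then push \<sigma> a st (out @ [t]) else (a # t # st, out))"

fun run_stack :: "nat list \<Rightarrow> nat list \<Rightarrow> nat list \<Rightarrow> nat list \<Rightarrow> nat list" where
  "run_stack \<sigma> [] st out = out @ st"
| "run_stack \<sigma> (a # p) st out =
     (case push \<sigma> a st out of (st', out') \<Rightarrow> run_stack \<sigma> p st' out')"

definition stack_map :: "nat list \<Rightarrow> nat list \<Rightarrow> nat list" where
  "stack_map \<sigma> p = run_stack \<sigma> p [] []"

definition Sort :: "nat list \<Rightarrow> nat list set" where
  "Sort \<sigma> = {p. is_perm p \<and> stack_map [2, 1] (stack_map \<sigma> p) = [1..<Suc (length p)]}"

text \<open>The formula for the skew sum agrees with its description by order isomorphism.\<close>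

lemma perm_nth_eq_card:
  assumes "is_perm p" "i < length p"
  shows "p ! i = Suc (card {j. j < length p \<and> p ! j < p ! i})"
proof -
  let ?J = "{j. j < length p \<and> p ! j < p ! i}"
  have d: "distinct p" and s: "set p = {1..length p}"
    using assms(1) by (auto simp: is_perm_def)
  have inj: "inj_on ((!) p) ?J"
    using d by (auto simp: inj_on_def nth_eq_iff_index_eq)
  have "p ! i \<in> set p"
    using assms(2) by simp
  then have r: "1 \<le> p ! i" "p ! i \<le> length p"
    using s by auto
  have "(!) p ` ?J = {v \<in> set p. v < p ! i}"
    by (force simp: in_set_conv_nth)
  also have "\<dots> = {1..<p ! i}"
    using r by (auto simp: s)
  finally have "card ?J = p ! i - 1"
    using card_image[OF inj] by simp
  then show ?thesis
    using r by simp
qed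

lemma order_iso_perm_eq:
  assumes "is_perm p" "is_perm q" "order_iso p q"
  shows "p = q"
proof (rule nth_equalityI)
  show len: "length p = length q"
    using assms(3) by (simp add: order_iso_def)
  fix i assume i: "i < length p"
  have "{j. j < length p \<and> p ! j < p ! i} = {j. j < length q \<and> q ! j < q ! i}"
    using assms(3) i len by (auto simp: order_iso_def)
  then show "p ! i = q ! i"
    using perm_nth_eq_card[OF assms(1) i] perm_nth_eq_card[OF assms(2)] i len by simp
qed

lemma is_perm_skew_sum:
  assumes "is_perm x" "is_perm y"
  shows "is_perm (x \<ominus> y)"
proof -
  have "(\<lambda>i. i + length y) ` {1..length x} = {1 + length y..length x + length y}"
    by (simp add: add.commute)
  then show ?thesis
    using assms by (auto simp: is_perm_def skew_sum_def distinct_map)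
qed

lemma skew_sum_iff:
  assumes x: "is_perm x" and y: "is_perm y"
  shows "z = x \<ominus> y \<longleftrightarrow>
    is_perm z \<and> length z = length x + length y \<and>
    order_iso (take (length x) z) x \<and> order_iso (drop (length x) z) y \<and>
    (\<forall>u\<in>set (take (length x) z). \<forall>v\<in>set (drop (length x) z). v < u)"
    (is "_ \<longleftrightarrow> ?R z")
proof
  assume "z = x \<ominus> y"
  then show "?R z"
    using x y is_perm_skew_sum[OF x y]
    by (auto simp: skew_sum_def order_iso_def is_perm_def)
next
  assume R: "?R z"
  have S: "?R (x \<ominus> y)"
    using x y is_perm_skew_sum[OF x y]
    by (auto simp: skew_sum_def order_iso_def is_perm_def)
  have iso: "w ! i < w ! j \<longleftrightarrow>
      (if i < length x
       then j < length x \<and> x ! i < x ! j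
       else j < length x \<or> y ! (i - length x) < y ! (j - length x))"
    if w: "?R w" and i: "i < length w" and j: "j < length w" for w i j
  proof -
    let ?a = "length x"
    have len: "length w = ?a + length y"
      using w by simp
    have lt: "w ! l < w ! k" if "k < ?a" "\<not> l < ?a" "l < length w" for k l
    proof -
      have "take ?a w ! k \<in> set (take ?a w)"
        using that len by (intro nth_mem) simp
      moreover have "drop ?a w ! (l - ?a) \<in> set (drop ?a w)"
        using that len by (intro nth_mem) simp
      ultimately have "drop ?a w ! (l - ?a) < take ?a w ! k"
        using w by blast
      then show ?thesis
        using that len by simp
    qed
    have top: "w ! k < w ! l \<longleftrightarrow> x ! k < x ! l" if "k < ?a" "l < ?a" for k l
    proof -
      have "take ?a w ! k < take ?a w ! l \<longleftrightarrow> x ! k < x ! l"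
        using w that len unfolding order_iso_def by simp
      then show ?thesis
        using that by simp
    qed
    have bot: "w ! k < w ! l \<longleftrightarrow> y ! (k - ?a) < y ! (l - ?a)"
      if "\<not> k < ?a" "k < length w" "\<not> l < ?a" "l < length w" for k l
    proof -
      have "order_iso (drop ?a w) y"
        using w by blast
      moreover have "k - ?a < length (drop ?a w)" "l - ?a < length (drop ?a w)"
        using that by simp_all
      ultimately have "drop ?a w ! (k - ?a) < drop ?a w ! (l - ?a) \<longleftrightarrow>
          y ! (k - ?a) < y ! (l - ?a)"
        unfolding order_iso_def by blast
      then show ?thesis
        using that len by simp
    qed
    show ?thesis
      using top[of i j] bot[of i j] lt[of i j] lt[of j i] i j
      by (cases "i < ?a"; cases "j < ?a") (auto simp del: not_less)
  qed
  have "order_iso z (x \<ominus> y)"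
    unfolding order_iso_def
  proof (intro conjI allI impI)
    show len: "length z = length (x \<ominus> y)"
      using R S by simp
    show "z ! i < z ! j \<longleftrightarrow> (x \<ominus> y) ! i < (x \<ominus> y) ! j"
      if "i < length z" "j < length z" for i j
      using iso[OF R that] iso[OF S, of i j] that len by simp
  qed
  then show "z = x \<ominus> y"
    using R S order_iso_perm_eq by blast
qed

end

theory Submission
  imports Defs "HOL-Library.Multiset"
begin

text \<open>
  The easy equivalence, between the skew sum and the condition on \<^term>\<open>hat \<sigma>\<close> and
  \<^term>\<open>rev \<sigma>\<close>, is about \<open>\<sigma>\<close> alone (\<open>skew_sum_12_iff\<close>): an occurrence of \<open>\<xi>\<close> in
  \<^term>\<open>rev \<sigma>\<close> is an ascent \<open>u < v\<close> of \<open>\<sigma>\<close> with last entry below \<open>u\<close>. Unless it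
  is formed by the two leading entries, which \<^term>\<open>hat \<sigma>\<close> swaps, \<open>u\<close>, \<open>v\<close> and the
  last entry are a 231 in \<^term>\<open>hat \<sigma>\<close>; and if it is, every other entry must lie below both,
  since \<open>u\<close>, an entry above \<open>u\<close> and the last entry would be a 231, too. Conversely, two leading
  entries in decreasing order and above all others take part in no 231.

  For sortability, recall that an output is sorted by the ordinary stack exactly when it avoids
  231 (\<open>Sort_iff\<close>). If the conditions hold, \<^term>\<open>rev \<sigma>\<close> itself is sortable and contains
  \<open>\<xi>\<close>: reading it, the stack first meets \<open>\<sigma>\<close> at the very last letter, which expels one entry, so
  the output is \<^term>\<open>hat \<sigma>\<close> (\<open>stack_map_rev_pattern\<close>).

  Conversely, let a sortable \<open>\<pi>\<close> with first entry \<open>m\<close> have consecutive entries \<open>b c\<close> with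
  \<open>m < c < b\<close> (\<open>sortable_containing_xi_imp_skew_sum\<close>). As \<open>\<sigma>\<close> has at least three entries, \<open>m\<close>
  stays at the bottom of the stack and leaves last. The output avoids 231, so no entry larger than
  \<open>c\<close> lies between \<open>c\<close> and \<open>m\<close> in it; hence \<open>b\<close> is popped before \<open>c\<close> is pushed, and everything then
  left below \<open>c\<close> is smaller than \<open>c\<close>. The last popped entry \<open>y\<close> gives an occurrence
  \<open>c y zs\<close> of \<open>\<sigma>\<close>. If \<open>y < c\<close>, then \<open>c\<close> would be the largest letter of the occurrence, and
  \<open>b y zs\<close> would have been an occurrence in the stack before. So \<open>zs < c < y\<close>, which is the shape
  \<open>12 \<ominus> \<beta>\<close>; and \<open>zs\<close> is a subsequence of the output, so \<open>\<beta>\<close> avoids 231.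
\<close>

(* Patterns are list literals, so the numeral 1 in them must not be rewritten to Suc 0. *)
declare One_nat_def [simp del]

(* As a rewrite rule this equation splits on equality of heads, which is unwanted for
   existentially quantified subsequences. *)
declare subseq_Cons2_iff [simp del]

section \<open>Order isomorphism and pattern containment\<close>

lemma subseq_Cons_nthI:
  assumes "i < length xs" "subseq zs (drop (Suc i) xs)"
  shows "subseq (xs ! i # zs) xs"
proof -
  have "subseq (xs ! i # zs) (take i xs @ xs ! i # drop (Suc i) xs)"
    using assms(2) by (intro list_emb_append2 subseq_Cons2)
  then show ?thesis
    using assms(1) by (simp add: id_take_nth_drop[symmetric])
qed

lemma subseq_nth_pairI:
  assumes "i < j" "j < length xs"
  shows "subseq [xs ! i, xs ! j] xs"
proof -
  have "xs ! j = drop (Suc i) xs ! (j - Suc i)"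
    using assms by simp
  moreover have "drop (Suc i) xs ! (j - Suc i) \<in> set (drop (Suc i) xs)"
    using assms by (intro nth_mem) simp
  ultimately show ?thesis
    using assms by (intro subseq_Cons_nthI) (auto simp: subseq_singleton_left)
qed

lemma subseq_nth_tripleI:
  assumes "i < j" "j < l" "l < length xs"
  shows "subseq [xs ! i, xs ! j, xs ! l] xs"
  using assms subseq_nth_pairI[of "j - Suc i" "l - Suc i" "drop (Suc i) xs"]
  by (intro subseq_Cons_nthI) auto

text \<open>Pairing the entries turns conditions on positions into conditions on set members, and these
  are inherited by sublists of the zipped list.\<close>

lemma order_iso_iff_zip:
  "order_iso xs ys \<longleftrightarrow> length xs = length ys \<and>
     (\<forall>p\<in>set (zip xs ys). \<forall>q\<in>set (zip xs ys). fst p < fst q \<longleftrightarrow> snd p < snd q)"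
proof (cases "length xs = length ys")
  case True
  have "(\<forall>p\<in>set (zip xs ys). P p) \<longleftrightarrow> (\<forall>i<length xs. P (xs ! i, ys ! i))" for P
    using True by (auto simp: set_zip)
  then show ?thesis
    unfolding order_iso_def by simp
qed (simp add: order_iso_def)

lemma order_iso_refl: "order_iso xs xs"
  by (simp add: order_iso_def)

lemma order_iso_trans: "order_iso xs ys \<Longrightarrow> order_iso ys zs \<Longrightarrow> order_iso xs zs"
  by (simp add: order_iso_def)

lemma order_iso_Cons:
  "order_iso (x # xs) (y # ys) \<longleftrightarrow> order_iso xs ys \<and>
     (\<forall>p\<in>set (zip xs ys). (x < fst p \<longleftrightarrow> y < snd p) \<and> (fst p < x \<longleftrightarrow> snd p < y))"
  by (auto simp: order_iso_iff_zip)

lemma order_iso_distinct: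
  assumes "order_iso xs ys" "distinct ys"
  shows "distinct xs"
proof -
  have "xs ! i \<noteq> xs ! j" if "i < length xs" "j < length xs" "i \<noteq> j" for i j
  proof -
    have "ys ! i \<noteq> ys ! j"
      using that assms by (simp add: order_iso_def nth_eq_iff_index_eq)
    then show ?thesis
      using that assms(1) unfolding order_iso_def by (metis linorder_neq_iff)
  qed
  then show ?thesis
    by (simp add: distinct_conv_nth)
qed

lemma contains_self: "contains xs xs"
  unfolding contains_def using order_iso_refl by blast

lemma contains_length: "contains xs \<tau> \<Longrightarrow> length \<tau> \<le> length xs"
  by (auto simp: contains_def order_iso_def dest: list_emb_length)

lemma contains_subseq: "subseq xs ys \<Longrightarrow> contains xs \<tau> \<Longrightarrow> contains ys \<tau>"
  unfolding contains_def by (meson subseq_order.order_trans)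

text \<open>The positions of an occurrence in one list also select an occurrence in the other. This
  transfers a pattern of \<open>\<beta>\<close> to the copy of \<open>\<beta>\<close> inside a stack.\<close>

lemma contains_order_iso:
  assumes "order_iso xs ys" "contains ys \<tau>"
  shows "contains xs \<tau>"
proof -
  obtain zs where zs: "subseq zs ys" "order_iso zs \<tau>"
    using assms(2) by (auto simp: contains_def)
  obtain N where N: "zs = nths ys N"
    using zs(1) by (auto simp: subseq_conv_nths)
  have len: "length xs = length ys"
    using assms(1) by (simp add: order_iso_def)
  let ?ps = "nths (zip xs ys) N"
  have m: "map fst ?ps = nths xs N" "map snd ?ps = zs"
    using len by (simp_all add: N flip: nths_map)
  have z: "zip (map fst ?ps) (map snd ?ps) = ?ps"
    by (rule zip_map_fst_snd)
  have "order_iso (nths xs N) zs"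
    unfolding m[symmetric] order_iso_iff_zip z
    using assms(1) by (auto simp: order_iso_iff_zip dest!: in_set_nthsD)
  then show ?thesis
    unfolding contains_def
    using zs(2) order_iso_trans subseq_conv_nths by blast
qed

lemma subseq_pair_Cons: "subseq [a, b] (x # xs) \<longleftrightarrow> subseq [a, b] xs \<or> a = x \<and> b \<in> set xs"
  by (auto simp: subseq_Cons2_iff subseq_singleton_left dest: subseq_Cons')

lemma subseq_triple_Cons:
  "subseq [a, b, c] (x # xs) \<longleftrightarrow> subseq [a, b, c] xs \<or> a = x \<and> subseq [b, c] xs"
  by (auto simp: subseq_Cons2_iff dest: subseq_Cons')

lemma contains_21_iff: "contains xs [2, 1] \<longleftrightarrow> (\<exists>a b. subseq [a, b] xs \<and> b < a)"
proof -
  have "order_iso ys [2, 1] \<longleftrightarrow> (\<exists>a b. ys = [a, b] \<and> b < a)" (is "_ \<longleftrightarrow> ?R") for ys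
  proof
    assume o: "order_iso ys [2, 1]"
    then obtain a b where "ys = [a, b]"
      by (auto simp: order_iso_def length_Suc_conv)
    then show ?R
      using o by (auto simp: order_iso_Cons)
  qed (auto simp: order_iso_Cons order_iso_refl)
  then show ?thesis
    by (auto simp: contains_def)
qed

lemma contains_231_iff:
  "contains xs [2, 3, 1] \<longleftrightarrow> (\<exists>a b c. subseq [a, b, c] xs \<and> c < a \<and> a < b)"
proof -
  have "order_iso ys [2, 3, 1] \<longleftrightarrow> (\<exists>a b c. ys = [a, b, c] \<and> c < a \<and> a < b)" (is "_ \<longleftrightarrow> ?R") for ys
  proof
    assume o: "order_iso ys [2, 3, 1]"
    then obtain a b c where "ys = [a, b, c]"
      by (auto simp: order_iso_def length_Suc_conv)
    then show ?R
      using o by (auto simp: order_iso_Cons)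
  qed (auto simp: order_iso_Cons order_iso_refl)
  then show ?thesis
    by (auto simp: contains_def)
qed

lemma avoids_21_iff_sorted: "\<not> contains xs [2, 1] \<longleftrightarrow> sorted xs"
proof (induction xs)
  case Nil
  then show ?case by (simp add: contains_21_iff)
next
  case (Cons x xs)
  have "contains (x # xs) [2, 1] \<longleftrightarrow> contains xs [2, 1] \<or> (\<exists>b\<in>set xs. b < x)"
    by (auto simp: contains_21_iff subseq_pair_Cons)
  then show ?case
    using Cons.IH by (auto simp: not_less)
qed

lemma contains_231_Cons:
  "contains (x # xs) [2, 3, 1] \<longleftrightarrow>
     contains xs [2, 3, 1] \<or> (\<exists>b c. subseq [b, c] xs \<and> c < x \<and> x < b)"
  by (auto simp: contains_231_iff subseq_triple_Cons)

lemma contains_231_Cons_upper_bound: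
  assumes "\<forall>y\<in>set xs. y \<le> x"
  shows "contains (x # xs) [2, 3, 1] \<longleftrightarrow> contains xs [2, 3, 1]"
proof -
  have "b \<in> set xs" if "subseq [b, c] xs" for b c
    using subseq_order.order_trans[OF _ that, of "[b]"] by (simp add: subseq_singleton_left)
  then show ?thesis
    using assms by (fastforce simp: contains_231_Cons)
qed

section \<open>The run of a pattern-avoiding stack\<close>

text \<open>The last popped entry is the one to blame: right before it left, the incoming letter, this
  entry and the surviving stack contained \<open>\<sigma>\<close>, but without it they do not.\<close>

lemma push_decomp:
  assumes "2 \<le> length \<sigma>"
  shows "\<exists>ps st'. st = ps @ st' \<and> push \<sigma> a st out = (a # st', out @ ps) \<and>
    \<not> contains (a # st') \<sigma> \<and> (ps \<noteq> [] \<longrightarrow> contains (a # last ps # st') \<sigma>)"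
proof (induction st arbitrary: out)
  case Nil
  then show ?case
    using assms contains_length[of "[a]" \<sigma>] by auto
next
  case (Cons t st)
  show ?case
  proof (cases "contains (a # t # st) \<sigma>")
    case True
    obtain ps st' where "st = ps @ st'" "push \<sigma> a st (out @ [t]) = (a # st', (out @ [t]) @ ps)"
      "\<not> contains (a # st') \<sigma>" "ps \<noteq> [] \<longrightarrow> contains (a # last ps # st') \<sigma>"
      using Cons.IH by blast
    with True show ?thesis
      by (intro exI[of _ "t # ps"] exI[of _ st']) auto
  qed auto
qed

text \<open>Entries are only inserted between output and stack, so the order in which a stack would be
  emptied now is the relative order in the final output.\<close>

lemma subseq_run_stack:
  assumes "2 \<le> length \<sigma>"
  shows "subseq (out @ st) (run_stack \<sigma> p st out)"
proof (induction p arbitrary: st out)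
  case (Cons a p)
  obtain ps st' where st: "st = ps @ st'" "push \<sigma> a st out = (a # st', out @ ps)"
    using push_decomp[OF assms] by metis
  have "subseq ((out @ ps) @ st') ((out @ ps) @ a # st')"
    by (intro list_emb_append_mono) auto
  also have "subseq \<dots> (run_stack \<sigma> p (a # st') (out @ ps))"
    by (rule Cons.IH)
  finally show ?case
    using st by simp
qed simp

lemma run_stack_extends_output:
  assumes "2 \<le> length \<sigma>"
  shows "\<exists>r. run_stack \<sigma> p st out = out @ r \<and> mset r = mset st + mset p"
proof (induction p arbitrary: st out)
  case (Cons a p)
  obtain ps st' where st: "st = ps @ st'" "push \<sigma> a st out = (a # st', out @ ps)"
    using push_decomp[OF assms] by metis
  obtain r where r: "run_stack \<sigma> p (a # st') (out @ ps) = (out @ ps) @ r"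
      "mset r = mset (a # st') + mset p"
    using Cons.IH by blast
  show ?case
    using st r by (intro exI[of _ "ps @ r"]) simp
qed simp

lemma mset_stack_map:
  assumes "2 \<le> length \<sigma>"
  shows "mset (stack_map \<sigma> p) = mset p"
  using run_stack_extends_output[OF assms, of p "[]" "[]"] by (auto simp: stack_map_def)

lemma is_perm_cong_mset: "mset p = mset q \<Longrightarrow> is_perm p \<longleftrightarrow> is_perm q"
  unfolding is_perm_def using mset_eq_setD mset_eq_length mset_eq_imp_distinct_iff by metis

text \<open>Every run can be inspected right after a prefix \<open>p\<close> of its input. The first letter is never popped if
  \<open>\<sigma>\<close> has at least three entries, because it and one incoming letter cannot contain \<open>\<sigma>\<close>; for
  length two it may well be popped.\<close>

lemma run_stack_prefix:
  assumes "2 \<le> length \<sigma>" "p \<noteq> []"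
  shows "\<exists>st out. (\<forall>q. stack_map \<sigma> (p @ q) = run_stack \<sigma> q st out) \<and>
    st \<noteq> [] \<and> hd st = last p \<and> (3 \<le> length \<sigma> \<longrightarrow> last st = hd p) \<and>
    \<not> contains st \<sigma> \<and> set p = set out \<union> set st"
  using assms(2)
proof (induction p rule: rev_nonempty_induct)
  case (single a)
  have "\<not> contains [a] \<sigma>"
    using assms(1) contains_length[of "[a]" \<sigma>] by auto
  then show ?case
    by (intro exI[of _ "[a]"] exI[of _ "[]"]) (simp add: stack_map_def)
next
  case (snoc a p)
  then obtain st out where IH: "\<And>q. stack_map \<sigma> (p @ q) = run_stack \<sigma> q st out"
    "st \<noteq> []" "3 \<le> length \<sigma> \<longrightarrow> last st = hd p" "set p = set out \<union> set st"
    by blast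
  obtain ps st' where st: "st = ps @ st'" "push \<sigma> a st out = (a # st', out @ ps)"
    "\<not> contains (a # st') \<sigma>" "ps \<noteq> [] \<longrightarrow> contains (a # last ps # st') \<sigma>"
    using push_decomp[OF assms(1)] by blast
  have "st' \<noteq> []" if "3 \<le> length \<sigma>"
    using that st(1,4) IH(2) contains_length[of "[a, last ps]" \<sigma>] by auto
  then show ?case
    using IH st snoc(1)
    by (intro exI[of _ "a # st'"] exI[of _ "out @ ps"]) auto
qed

lemma run_stack_no_pop:
  assumes "length p + length st < length \<sigma>"
  shows "run_stack \<sigma> (p @ q) st out = run_stack \<sigma> q (rev p @ st) out"
  using assms
proof (induction p arbitrary: st)
  case (Cons a p)
  have "push \<sigma> a st out = (a # st, out)"
    using Cons.prems contains_length[of "a # st" \<sigma>] by (cases st) auto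
  then show ?case
    using Cons.IH[of "a # st"] Cons.prems by simp
qed simp

text \<open>The first pop happens when the whole pattern has been read and stands in the stack. It
  removes the second entry of \<open>\<sigma>\<close>, and what is left is too short to contain \<open>\<sigma>\<close>.\<close>

lemma stack_map_rev_pattern:
  assumes "2 \<le> length \<sigma>"
  shows "stack_map \<sigma> (rev \<sigma>) = hat \<sigma>"
proof -
  obtain x y \<beta> where \<sigma>: "\<sigma> = x # y # \<beta>"
    using assms by (metis Suc_le_length_iff numeral_2_eq_2)
  have "\<not> contains (x # \<beta>) \<sigma>"
    using contains_length[of "x # \<beta>" \<sigma>] by (auto simp: \<sigma>)
  then have "push \<sigma> x \<beta> [y] = (x # \<beta>, [y])"
    by (cases \<beta>) auto
  moreover have "contains (x # y # \<beta>) \<sigma>"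
    by (simp add: \<sigma> contains_self)
  moreover have "stack_map \<sigma> (rev \<sigma>) = run_stack \<sigma> [x] (y # \<beta>) []"
    unfolding stack_map_def
    using run_stack_no_pop[of "rev \<beta> @ [y]" "[]" \<sigma> "[x]" "[]"] by (simp add: \<sigma>)
  ultimately show ?thesis
    by (simp add: \<sigma>)
qed

section \<open>The ordinary stack\<close>

text \<open>An entry \<open>x\<close> is popped only by a larger letter \<open>a\<close>. A later letter below \<open>x\<close> would complete
  a 231, so the output so far is a lower bound for all that follows. The hypotheses are the
  invariant: the third one excludes 231 with its first letter already in the stack.\<close>

lemma sorted_run_stack_21:
  assumes "sorted (out @ st)" "\<forall>x\<in>set out. \<forall>y\<in>set p. x \<le> y"
    and "\<forall>x\<in>set st. \<not> contains (x # p) [2, 3, 1]" "\<not> contains p [2, 3, 1]"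
  shows "sorted (run_stack [2, 1] p st out)"
  using assms
proof (induction p arbitrary: st out)
  case (Cons a p)
  obtain ps st' where st: "st = ps @ st'" "push [2, 1] a st out = (a # st', out @ ps)"
    "\<not> contains (a # st') [2, 1]" "ps \<noteq> [] \<longrightarrow> contains (a # last ps # st') [2, 1]"
    using push_decomp[of "[2, 1]" st a out] by (simp del: push.simps) blast
  have srt: "sorted (out @ ps @ st')" "sorted (a # st')"
    using Cons.prems(1) st(1,3) by (auto simp: avoids_21_iff_sorted)
  have ps: "x < a" if x: "x \<in> set ps" for x
  proof -
    have ne: "ps \<noteq> []"
      using x by auto
    have "sorted (butlast ps @ [last ps])"
      using srt(1) ne by (simp add: sorted_append)
    then have "\<forall>z\<in>set (butlast ps @ [last ps]). z \<le> last ps"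
      unfolding sorted_append by simp
    then have "x \<le> last ps"
      using x ne by simp
    moreover have "\<not> sorted (a # last ps # st')"
      using st(4) ne avoids_21_iff_sorted by blast
    moreover have "sorted (last ps # st')"
      using srt(1) ne by (auto simp: sorted_append)
    ultimately show ?thesis
      using srt(2) by auto
  qed
  have "x \<le> y" if "x \<in> set ps" "y \<in> set p" for x y
  proof (rule ccontr)
    assume "\<not> x \<le> y"
    then have "contains (x # a # p) [2, 3, 1]"
      using ps[OF that(1)] that(2)
      by (fastforce simp: contains_231_Cons[of x] subseq_pair_Cons)
    then show False
      using Cons.prems(3) that(1) by (simp add: st(1))
  qed
  moreover have "sorted ((out @ ps) @ a # st')"
    using srt ps Cons.prems(2) by (auto simp: sorted_append less_imp_le)
  moreover have "\<not> contains p [2, 3, 1]" "\<not> contains (a # p) [2, 3, 1]"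
    using Cons.prems(4) by (simp_all add: contains_231_Cons)
  moreover have "\<forall>x\<in>set st'. \<not> contains (x # p) [2, 3, 1]"
  proof
    fix x assume "x \<in> set st'"
    moreover have "subseq (x # p) (x # a # p)"
      by auto
    ultimately show "\<not> contains (x # p) [2, 3, 1]"
      using Cons.prems(3) contains_subseq st(1) by (metis Un_iff set_append)
  qed
  ultimately have "sorted (run_stack [2, 1] p (a # st') (out @ ps))"
    using Cons.prems(2) by (intro Cons.IH) auto
  then show ?case
    using st(2) by simp
qed simp

text \<open>If \<open>a b c\<close> is an occurrence of 231, pushing \<open>b\<close> forces \<open>a\<close> out before \<open>c\<close> is even read.\<close>

lemma sorted_stack_map_21_imp_avoids_231:
  assumes "sorted (stack_map [2, 1] w)"
  shows "\<not> contains w [2, 3, 1]"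
proof
  assume "contains w [2, 3, 1]"
  then obtain a b c where abc: "subseq [a, b, c] w" "c < a" "a < b"
    by (auto simp: contains_231_iff)
  obtain w1 w2 where w: "w = w1 @ a # w2" "subseq [b, c] w2"
    using list_emb_ConsD[OF abc(1)] by auto
  obtain w3 w4 where w2: "w2 = w3 @ b # w4" "c \<in> set w4"
    using list_emb_ConsD[OF w(2)] by (auto simp: subseq_singleton_left)
  define p where "p = w1 @ a # w3 @ [b]"
  obtain st out where st: "\<forall>q. stack_map [2, 1] (p @ q) = run_stack [2, 1] q st out"
    "st \<noteq> []" "hd st = last p" "\<not> contains st [2, 1]" "set p = set out \<union> set st"
    using run_stack_prefix[of "[2, 1]" p] by (auto simp: p_def)
  have eq: "stack_map [2, 1] w = run_stack [2, 1] w4 st out"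
    using st(1)[rule_format, of w4] by (simp add: w w2 p_def)
  have "hd st = b"
    using st(3) by (simp add: p_def)
  then have "\<forall>x\<in>set st. b \<le> x"
    using st(2,4) by (cases st) (auto simp: avoids_21_iff_sorted)
  then have "a \<in> set out"
    using st(5) abc(3) by (force simp: p_def)
  moreover obtain r where r: "run_stack [2, 1] w4 st out = out @ r" "mset r = mset st + mset w4"
    using run_stack_extends_output[of "[2, 1]" w4 st out] by auto
  moreover have "c \<in> set r"
    using r(2) w2(2) by (metis Un_iff set_mset_mset set_mset_union)
  ultimately have "a \<le> c"
    using assms by (auto simp: eq sorted_append)
  then show False
    using abc(2) by simp
qed

lemma sortable_21_iff:
  assumes "is_perm w"
  shows "stack_map [2, 1] w = [1..<Suc (length w)] \<longleftrightarrow> \<not> contains w [2, 3, 1]"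
proof
  assume "stack_map [2, 1] w = [1..<Suc (length w)]"
  then show "\<not> contains w [2, 3, 1]"
    by (intro sorted_stack_map_21_imp_avoids_231) (simp del: upt_Suc)
next
  assume "\<not> contains w [2, 3, 1]"
  then have s: "sorted (stack_map [2, 1] w)"
    unfolding stack_map_def by (intro sorted_run_stack_21) auto
  have "mset (stack_map [2, 1] w) = mset w"
    by (simp add: mset_stack_map)
  then have "is_perm (stack_map [2, 1] w)" "length (stack_map [2, 1] w) = length w"
    using assms is_perm_cong_mset mset_eq_length by blast+
  then have "distinct (stack_map [2, 1] w)" "set (stack_map [2, 1] w) = set [1..<Suc (length w)]"
    by (auto simp only: is_perm_def set_upt atLeastLessThanSuc_atLeastAtMost)
  then show "stack_map [2, 1] w = [1..<Suc (length w)]"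
    using s by (intro sorted_distinct_set_unique sorted_upt distinct_upt)
qed

lemma Sort_iff:
  assumes "2 \<le> length \<sigma>"
  shows "p \<in> Sort \<sigma> \<longleftrightarrow> is_perm p \<and> \<not> contains (stack_map \<sigma> p) [2, 3, 1]"
proof -
  have m: "mset (stack_map \<sigma> p) = mset p"
    by (rule mset_stack_map[OF assms])
  have "length (stack_map \<sigma> p) = length p"
    using mset_eq_length[OF m] .
  then show ?thesis
    unfolding Sort_def
    using sortable_21_iff[of "stack_map \<sigma> p"] is_perm_cong_mset[OF m] by auto
qed

section \<open>Sortable permutations containing \<open>\<xi>\<close>\<close>

text \<open>In a permutation, two leading entries above all others can only be the two largest values, so
  the tail needs no standardization.\<close>

lemma is_perm_top_pair:
  assumes p: "is_perm (x # y # \<beta>)" and xy: "x < y" and \<beta>: "\<forall>v\<in>set \<beta>. v < x"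
  shows "is_perm \<beta>" "x # y # \<beta> = [1, 2] \<ominus> \<beta>"
proof -
  let ?k = "length \<beta>"
  have d: "distinct (x # y # \<beta>)" and s: "{x, y} \<union> set \<beta> = {1..?k + 2}"
    using p by (auto simp: is_perm_def)
  have "?k + 2 \<in> {x, y} \<union> set \<beta>" "y \<in> {1..?k + 2}"
    using s by auto
  then have y: "y = ?k + 2"
    using xy \<beta> by fastforce
  have "?k + 1 \<in> {x, y} \<union> set \<beta>"
    using s by auto
  then have x: "x = ?k + 1"
    using xy \<beta> y by fastforce
  have "set \<beta> = {1..?k + 2} - {x, y}"
    using d s by auto
  also have "\<dots> = {1..?k}"
    unfolding x y by auto
  finally show "is_perm \<beta>"
    using d by (simp add: is_perm_def)
  show "x # y # \<beta> = [1, 2] \<ominus> \<beta>"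
    by (simp add: skew_sum_def x y)
qed

lemma is_perm_hat: "is_perm (hat \<sigma>) \<longleftrightarrow> is_perm \<sigma>"
  by (rule is_perm_cong_mset) (cases \<sigma> rule: hat.cases; simp)

lemma skew_sum_12_iff:
  assumes p: "is_perm \<sigma>" and len: "3 \<le> length \<sigma>"
  shows "(\<exists>\<beta> \<in> Av [2, 3, 1]. \<sigma> = [1, 2] \<ominus> \<beta>) \<longleftrightarrow> hat \<sigma> \<in> Av [2, 3, 1] \<and> rev \<sigma> \<notin> Av_xi"
proof
  assume "\<exists>\<beta> \<in> Av [2, 3, 1]. \<sigma> = [1, 2] \<ominus> \<beta>"
  then obtain \<beta> where \<beta>: "is_perm \<beta>" "\<not> contains \<beta> [2, 3, 1]" "\<sigma> = [1, 2] \<ominus> \<beta>"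
    by (auto simp: Av_def)
  let ?k = "length \<beta>"
  have \<sigma>: "\<sigma> = Suc ?k # Suc (Suc ?k) # \<beta>"
    by (simp add: \<beta>(3) skew_sum_def)
  have le: "v \<le> ?k" if "v \<in> set \<beta>" for v
    using that \<beta>(1) by (auto simp: is_perm_def)
  have "contains (hat \<sigma>) [2, 3, 1] \<longleftrightarrow> contains \<beta> [2, 3, 1]"
    using le by (simp add: \<sigma> contains_231_Cons_upper_bound le_SucI)
  then have "hat \<sigma> \<in> Av [2, 3, 1]"
    using \<beta>(2) p by (simp add: Av_def is_perm_hat)
  moreover have "contains_xi (rev \<sigma>)"
  proof -
    have ne: "\<beta> \<noteq> []"
      using len by (auto simp: \<sigma>)
    then have "(rev \<beta> @ [Suc (Suc ?k), Suc ?k]) ! 0 = last \<beta>"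
      by (simp add: nth_append hd_rev flip: hd_conv_nth)
    then show ?thesis
      unfolding contains_xi_def
      using ne le[of "last \<beta>"] len
      by (intro exI[of _ "Suc ?k"]) (auto simp: \<sigma> nth_append Suc_le_eq)
  qed
  ultimately show "hat \<sigma> \<in> Av [2, 3, 1] \<and> rev \<sigma> \<notin> Av_xi"
    by (simp add: Av_xi_def)
next
  assume R: "hat \<sigma> \<in> Av [2, 3, 1] \<and> rev \<sigma> \<notin> Av_xi"
  have "length \<sigma> = Suc (Suc (Suc (length \<sigma> - 3)))"
    using len by simp
  then obtain x y \<beta> where \<sigma>: "\<sigma> = x # y # \<beta>" and ne: "\<beta> \<noteq> []"
    by (metis length_Suc_conv list.discI)
  have hat: "\<not> contains (y # x # \<beta>) [2, 3, 1]"
    using R by (simp add: \<sigma> Av_def)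
  (* An entry of the tail, any earlier entry below it, and the last entry are a potential 231. *)
  let ?h = "y # x # \<beta>"
  have no_rise: "\<not> (last \<beta> < ?h ! i \<and> ?h ! i < \<beta> ! j)" if "i < j + 2" "j < length \<beta>" for i j
  proof
    assume *: "last \<beta> < ?h ! i \<and> ?h ! i < \<beta> ! j"
    let ?l = "length \<beta> - 1"
    have "\<beta> ! ?l = last \<beta>"
      using ne by (simp add: last_conv_nth)
    then have "j < ?l"
      using * that(2) by (cases "j = ?l") auto
    then have "subseq [?h ! i, ?h ! (j + 2), ?h ! (?l + 2)] ?h"
      using that ne by (intro subseq_nth_tripleI) auto
    then have "subseq [?h ! i, \<beta> ! j, last \<beta>] ?h"
      using \<open>\<beta> ! ?l = last \<beta>\<close> by simp
    then show False
      using hat * unfolding contains_231_iff by blast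
  qed
  obtain i where i: "2 \<le> i" "i + 1 \<le> length \<sigma>" "rev \<sigma> ! 0 < rev \<sigma> ! i" "rev \<sigma> ! i < rev \<sigma> ! (i - 1)"
    using R p by (auto simp: Av_xi_def contains_xi_def is_perm_def)
  define j where "j = length \<sigma> - Suc i"
  have j: "j = length \<sigma> - Suc i" "Suc j = length \<sigma> - Suc (i - 1)" "j < length \<beta>"
    using i(1,2) ne by (auto simp: j_def \<sigma>)
  have idx: "rev \<sigma> ! i = \<sigma> ! j" "rev \<sigma> ! (i - 1) = \<sigma> ! Suc j"
    using i(1,2) unfolding j_def by (simp_all add: rev_nth Suc_diff_Suc)
  have "rev \<sigma> ! 0 = last \<sigma>"
    using \<sigma> by (simp add: rev_nth last_conv_nth One_nat_def del: rev.simps)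
  then have "rev \<sigma> ! 0 = last \<beta>"
    using ne by (simp add: \<sigma>)
  have \<sigma>j: "last \<beta> < \<sigma> ! j" "\<sigma> ! j < \<sigma> ! Suc j"
    using i(3,4) idx \<open>rev \<sigma> ! 0 = last \<beta>\<close> by simp_all
  (* An ascent that starts later ends in the tail and has its lower entry earlier in the hat. *)
  have "j = 0"
  proof (rule ccontr)
    assume "j \<noteq> 0"
    then obtain l where l: "j = Suc l"
      by (cases j) auto
    have "l < length \<beta>"
      using j(3) l by simp
    moreover have "\<exists>i<l + 2. \<sigma> ! j = ?h ! i"
    proof (cases l)
      case 0
      then show ?thesis
        by (intro exI[of _ 0]) (simp add: l \<sigma> One_nat_def)
    next
      case (Suc n)
      then show ?thesis
        by (intro exI[of _ j]) (simp add: l \<sigma>)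
    qed
    ultimately show False
      using no_rise[of _ l] \<sigma>j by (auto simp: l \<sigma>)
  qed
  then have xy: "last \<beta> < x" "x < y"
    using \<sigma>j by (simp_all add: \<sigma>)
  have d: "x \<notin> set \<beta>"
    using p by (simp add: is_perm_def \<sigma>)
  have "\<forall>v\<in>set \<beta>. v < x"
  proof
    fix v assume v: "v \<in> set \<beta>"
    then obtain j where "j < length \<beta>" "\<beta> ! j = v"
      by (auto simp: in_set_conv_nth)
    then have "\<not> x < v"
      using no_rise[of 1 j] xy(1) by simp
    then show "v < x"
      using v d by (cases v x rule: linorder_cases) auto
  qed
  then have "is_perm \<beta>" "\<sigma> = [1, 2] \<ominus> \<beta>"
    using is_perm_top_pair[of x y \<beta>] p xy(2) by (simp_all add: \<sigma>)
  moreover have "\<not> contains \<beta> [2, 3, 1]"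
    using hat by (simp add: contains_231_Cons)
  ultimately show "\<exists>\<beta> \<in> Av [2, 3, 1]. \<sigma> = [1, 2] \<ominus> \<beta>"
    by (auto simp: Av_def)
qed

lemma sortable_containing_xi_imp_skew_sum:
  assumes p: "is_perm \<sigma>" and len: "3 \<le> length \<sigma>"
    and \<pi>: "\<pi> \<in> Sort \<sigma>" "contains_xi \<pi>"
  shows "\<exists>\<beta> \<in> Av [2, 3, 1]. \<sigma> = [1, 2] \<ominus> \<beta>"
proof -
  have len2: "2 \<le> length \<sigma>"
    using len by simp
  let ?\<tau> = "stack_map \<sigma> \<pi>"
  have av: "\<not> contains ?\<tau> [2, 3, 1]"
    using \<pi>(1) len2 by (simp add: Sort_iff)
  obtain i where i: "2 \<le> i" "i < length \<pi>" "\<pi> ! 0 < \<pi> ! i" "\<pi> ! i < \<pi> ! (i - 1)"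
    using \<pi>(2) by (auto simp: contains_xi_def)
  define m b c where "m = \<pi> ! 0" and "b = \<pi> ! (i - 1)" and "c = \<pi> ! i"
  define pre where "pre = take i \<pi>"
  define post where "post = drop (Suc i) \<pi>"
  have mcb: "m < c" "c < b"
    using i by (simp_all add: m_def b_def c_def)
  have "\<pi> \<noteq> []" "take i \<pi> \<noteq> []"
    using i by auto
  then have pre: "pre \<noteq> []" "hd pre = m" "last pre = b"
    using i by (simp_all add: pre_def m_def b_def hd_conv_nth last_conv_nth)
  have \<pi>_eq: "\<pi> = pre @ c # post"
    using i by (simp add: pre_def post_def c_def id_take_nth_drop)
  obtain st out where st: "\<forall>q. stack_map \<sigma> (pre @ q) = run_stack \<sigma> q st out"
    "st \<noteq> []" "hd st = b" "last st = m" "\<not> contains st \<sigma>"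
    using run_stack_prefix[OF len2 pre(1)] pre(2,3) len by auto
  obtain ps st' where push: "st = ps @ st'" "push \<sigma> c st out = (c # st', out @ ps)"
    "\<not> contains (c # st') \<sigma>" "ps \<noteq> [] \<longrightarrow> contains (c # last ps # st') \<sigma>"
    using push_decomp[OF len2] by blast
  have \<tau>: "?\<tau> = run_stack \<sigma> post (c # st') (out @ ps)"
    using st(1) push(2) by (simp add: \<pi>_eq)
  have sub: "subseq (c # st') ?\<tau>"
    using subseq_run_stack[OF len2, of "out @ ps" "c # st'" post] unfolding \<tau>
    by (meson list_emb_append2 subseq_order.order_refl subseq_order.order_trans)
  have "st' \<noteq> []"
    using push(1,4) st(2) contains_length[of "[c, last ps]" \<sigma>] len by auto
  then have last_st': "last st' = m"
    using push(1) st(4) by simp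
  (* Otherwise c z m would be a 231 in the output. *)
  have below: "z \<le> c" if z: "z \<in> set st'" for z
  proof (rule ccontr)
    assume "\<not> z \<le> c"
    then have "z \<noteq> m" "c < z"
      using mcb by auto
    have "subseq [z, m] st'"
    proof -
      obtain s1 s2 where s: "st' = s1 @ z # s2"
        using z by (meson split_list)
      then have "m \<in> set s2"
        using last_st' \<open>z \<noteq> m\<close> by (auto split: if_splits)
      then show ?thesis
        unfolding s by (intro list_emb_append2 subseq_Cons2) (simp add: subseq_singleton_left)
    qed
    then have "contains (c # st') [2, 3, 1]"
      using mcb \<open>c < z\<close> by (auto simp: contains_231_Cons)
    then show False
      using av sub contains_subseq by blast
  qed
  have "ps \<noteq> []"
  proof
    assume "ps = []"
    then have "b \<in> set st'"
      using push(1) st(2,3) by auto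
    then show False
      using below mcb by fastforce
  qed
  define y where "y = last ps"
  obtain ys where ys: "subseq ys (c # y # st')" "order_iso ys \<sigma>"
    using push(4) \<open>ps \<noteq> []\<close> by (auto simp: contains_def y_def)
  have st_y: "st = butlast ps @ y # st'"
    using push(1) \<open>ps \<noteq> []\<close> by (simp add: y_def)
  (* The occurrence must use c, since the old stack avoids the pattern, and y, since the new one
     does. *)
  have n1: "\<not> subseq ys (y # st')"
    using st(5) ys(2) list_emb_append2[of "(=)" ys "y # st'" "butlast ps"]
    unfolding st_y contains_def by blast
  have n2: "\<not> subseq ys (c # st')"
    using push(3) ys(2) by (auto simp: contains_def)
  obtain zs where zs: "ys = c # y # zs" "subseq zs st'"
  proof -
    obtain ys1 where ys1: "ys = c # ys1" "subseq ys1 (y # st')"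
      using ys(1) n1 by (cases ys) (simp_all add: subseq_Cons2_iff split: if_splits)
    moreover have "\<not> subseq ys1 st'"
      using n2 ys1(1) by auto
    ultimately show ?thesis
      using that by (cases ys1) (simp_all add: subseq_Cons2_iff split: if_splits)
  qed
  have dys: "distinct ys"
    using order_iso_distinct ys(2) p by (auto simp: is_perm_def)
  have zs_below: "z < c" if "z \<in> set zs" for z
  proof -
    have "subseq [z] st'"
      using that zs(2) subseq_order.order_trans[of "[z]" zs] by (simp add: subseq_singleton_left)
    then have "z \<le> c"
      using below by (simp add: subseq_singleton_left)
    moreover have "z \<noteq> c"
      using dys that by (auto simp: zs(1))
    ultimately show ?thesis
      by simp
  qed
  have "c < y"
  proof (rule ccontr)
    assume "\<not> c < y"
    then have yc: "y < c"
      using dys zs(1) by auto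
    have "butlast ps \<noteq> []"
      using st(3) yc mcb by (auto simp: st_y)
    then obtain us where us: "butlast ps = b # us"
      using st(3) by (cases "butlast ps") (auto simp: st_y)
    (* Both c and b exceed everything in y zs, so b can replace c. *)
    have "order_iso (b # y # zs) (c # y # zs)"
      using yc zs_below mcb(2)
      by (subst order_iso_Cons) (auto simp: order_iso_refl zip_same dest!: zs_below)
    then have "order_iso (b # y # zs) \<sigma>"
      using ys(2) zs(1) order_iso_trans by blast
    moreover have "subseq (b # y # zs) st"
      unfolding st_y us append_Cons
      by (intro subseq_Cons2 list_emb_append2 zs(2))
    ultimately show False
      using st(5) by (auto simp: contains_def)
  qed
  obtain s1 s2 \<beta> where \<sigma>: "\<sigma> = s1 # s2 # \<beta>"
    using len2 by (metis Suc_le_length_iff numeral_2_eq_2)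
  have iso: "order_iso (c # y # zs) (s1 # s2 # \<beta>)"
    using ys(2) by (simp add: zs(1) \<sigma>)
  then have iso_zs: "order_iso zs \<beta>" and lz: "length zs = length \<beta>"
    by (simp_all add: order_iso_Cons) (simp add: order_iso_def)
  have "s1 < s2"
    using iso \<open>c < y\<close> by (simp add: order_iso_Cons)
  moreover have "\<forall>v\<in>set \<beta>. v < s1"
  proof
    fix v assume "v \<in> set \<beta>"
    then obtain z where z: "(z, v) \<in> set (zip zs \<beta>)"
      using lz by (metis in_set_impl_in_set_zip2)
    then have "z < c"
      using zs_below set_zip_leftD by fastforce
    then show "v < s1"
      using iso z by (fastforce simp: order_iso_Cons)
  qed
  ultimately have "is_perm \<beta>" "\<sigma> = [1, 2] \<ominus> \<beta>"
    using is_perm_top_pair[of s1 s2 \<beta>] p by (simp_all add: \<sigma>)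
  moreover have "\<not> contains \<beta> [2, 3, 1]"
  proof
    assume "contains \<beta> [2, 3, 1]"
    then have "contains zs [2, 3, 1]"
      using contains_order_iso iso_zs by blast
    moreover have "subseq zs (c # st')"
      using zs(2) by auto
    ultimately show False
      using av sub contains_subseq by blast
  qed
  ultimately show ?thesis
    by (auto simp: Av_def)
qed

theorem theorem3p16:
  fixes \<sigma> :: "nat list"
  assumes "is_perm \<sigma>" and "length \<sigma> \<ge> 3"
  shows "(\<not> Sort \<sigma> \<subseteq> Av_xi \<longleftrightarrow> (\<exists>\<beta> \<in> Av [2, 3, 1]. \<sigma> = [1, 2] \<ominus> \<beta>)) \<and>
         ((\<exists>\<beta> \<in> Av [2, 3, 1]. \<sigma> = [1, 2] \<ominus> \<beta>) \<longleftrightarrow> hat \<sigma> \<in> Av [2, 3, 1] \<and> rev \<sigma> \<notin> Av_xi)"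
proof (intro conjI iffI)
  assume "\<not> Sort \<sigma> \<subseteq> Av_xi"
  then obtain \<pi> where "\<pi> \<in> Sort \<sigma>" "contains_xi \<pi>"
    by (auto simp: Av_xi_def Sort_def)
  then show "\<exists>\<beta> \<in> Av [2, 3, 1]. \<sigma> = [1, 2] \<ominus> \<beta>"
    by (rule sortable_containing_xi_imp_skew_sum[OF assms])
next
  assume "\<exists>\<beta> \<in> Av [2, 3, 1]. \<sigma> = [1, 2] \<ominus> \<beta>"
  then have *: "hat \<sigma> \<in> Av [2, 3, 1]" "rev \<sigma> \<notin> Av_xi"
    using skew_sum_12_iff[OF assms] by auto
  have "is_perm (rev \<sigma>)"
    using assms(1) by (simp add: is_perm_def)
  then have "rev \<sigma> \<in> Sort \<sigma>"
    using *(1) assms(2) by (simp add: Sort_iff stack_map_rev_pattern Av_def)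
  then show "\<not> Sort \<sigma> \<subseteq> Av_xi"
    using *(2) by blast
qed (use skew_sum_12_iff[OF assms] in auto)

end
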